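(* Let $T_1>\varepsilon_1>0$ and $T_2>\varepsilon_2>0$, and let $f$ be a function that is $C^1$ on $[-T_1,-\varepsilon_1]$ and on $[\varepsilon_2,T_2]$ (and possibly singular at $0$). Let $f_{T,\varepsilon}$ be its doubly truncated function and let $f'_{T,\varepsilon}$ be the derivative of $f_{T,\varepsilon}$ including the delta contributions $\delta_{\mathrm{trc}}$ generated by the truncation discontinuities, both as defined in the context. Then in integration by parts the boundary terms are compensated exactly by the delta contributions: for every smooth function $g$ on $\mathbb{R}$, $$\int_{-\infty}^{\infty}f'_{T,\varepsilon}(t)\,g(t)\,dt=-\int_{-\infty}^{\infty}f_{T,\varepsilon}(t)\,g'(t)\,dt .$$
   Context: The doubly truncated function is $f_{T,\varepsilon}(t)=f(t)$ for $-T_1\le t\le-\varepsilon_1$ or $\varepsilon_2\le t\le T_2$, and $f_{T,\varepsilon}(t)=0$ otherwise; it is defined on all of $\mathbb{R}$, is piecewise $C^1$ and has compact support. Its derivative is $f'_{T,\varepsilon}=f'\cdot\mathbf{1}_{[-T_1,-\varepsilon_1]\cup[\varepsilon_2,T_2]}+\delta_{\mathrm{trc}}$, where $$\delta_{\mathrm{trc}}(t)=f(-T_1)\,\delta(t+T_1)-f(-\varepsilon_1)\,\delta(t+\varepsilon_1)+f(\varepsilon_2)\,\delta(t-\varepsilon_2)-f(T_2)\,\delta(t-T_2)$$ and $\delta$ is the Dirac delta. Thus $$\int_{-\infty}^{\infty}f'_{T,\varepsilon}\,g\,dt=\Big(\int_{-T_1}^{-\varepsilon_1}+\int_{\varepsilon_2}^{T_2}\Big)f'(t)g(t)\,dt+f(-T_1)g(-T_1)-f(-\varepsilon_1)g(-\varepsilon_1)+f(\varepsilon_2)g(\varepsilon_2)-f(T_2)g(T_2).$$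 *)

theory Defs
  imports "HOL-Analysis.Analysis"
begin

text \<open>The scalar type \<open>'a\<close> below is instantiated by both \<open>real\<close> and \<open>complex\<close>.\<close>

text \<open>The derivative is taken relative to \<open>S\<close>, hence it is one-sided at the endpoints of a closed
  interval.  The library's \<open>C1_differentiable_on\<close> is stronger: it asks for two-sided
  differentiability at every point of \<open>S\<close>.\<close>

definition C1_within :: "(real \<Rightarrow> 'a::real_normed_vector) \<Rightarrow> real set \<Rightarrow> bool" where
  "C1_within f S \<longleftrightarrow>
     (\<exists>D. continuous_on S D \<and> (\<forall>t\<in>S. (f has_vector_derivative D t) (at t within S)))"

definition smooth_fun :: "(real \<Rightarrow> 'a::real_normed_vector) \<Rightarrow> bool" where
  "smooth_fun g \<longleftrightarrow>
     (\<forall>n t. ((\<lambda>h s. vector_derivative h (at s)) ^^ n) g differentiable (at t))"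

definition trunc_set :: "real \<Rightarrow> real \<Rightarrow> real \<Rightarrow> real \<Rightarrow> real set" where
  "trunc_set T1 e1 e2 T2 = {-T1..-e1} \<union> {e2..T2}"

definition truncated ::
  "real \<Rightarrow> real \<Rightarrow> real \<Rightarrow> real \<Rightarrow> (real \<Rightarrow> 'a::real_normed_vector) \<Rightarrow> real \<Rightarrow> 'a" where
  "truncated T1 e1 e2 T2 f t = (if t \<in> trunc_set T1 e1 e2 T2 then f t else 0)"

text \<open>Generalized functions on the line are represented by their pairing with test functions:
  the value at \<open>g\<close> is what is informally written \<open>\<integral>u(t) g(t) dt\<close>.\<close>

type_synonym 'a gen_fun = "(real \<Rightarrow> 'a) \<Rightarrow> 'a"

definition regular ::
  "(real \<Rightarrow> 'a) \<Rightarrow> 'a::{real_normed_field, euclidean_space} gen_fun" where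
  "regular h = (\<lambda>g. \<integral>t. h t * g t \<partial>lborel)"

text \<open>The shifted delta \<open>\<delta>(t - a)\<close>.\<close>

definition dirac :: "real \<Rightarrow> 'a gen_fun" where
  "dirac a = (\<lambda>g. g a)"

definition delta_trc ::
  "real \<Rightarrow> real \<Rightarrow> real \<Rightarrow> real \<Rightarrow> (real \<Rightarrow> 'a) \<Rightarrow> 'a::{real_normed_field, euclidean_space} gen_fun" where
  "delta_trc T1 e1 e2 T2 f =
     (\<lambda>g. f (-T1) * dirac (-T1) g - f (-e1) * dirac (-e1) g
        + f e2 * dirac e2 g - f T2 * dirac T2 g)"

text \<open>The pointwise derivative is again relative to the truncation set, i.e. one-sided at its four
  endpoints and the ordinary derivative in its interior.\<close>

definition truncated_deriv ::
  "real \<Rightarrow> real \<Rightarrow> real \<Rightarrow> real \<Rightarrow> (real \<Rightarrow> 'a) \<Rightarrow> 'a::{real_normed_field, euclidean_space} gen_fun" where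
  "truncated_deriv T1 e1 e2 T2 f =
     (\<lambda>g. regular (\<lambda>t. indicator (trunc_set T1 e1 e2 T2) t *\<^sub>R
                        vector_derivative f (at t within trunc_set T1 e1 e2 T2)) g
        + delta_trc T1 e1 e2 T2 f g)"

end

theory Submission
  imports Defs
begin

text \<open>The function \<open>f\<close> is \<open>C\<^sup>1\<close> up to the endpoints of each of the two intervals that make up the
  truncation set, so ordinary integration by parts holds on each interval separately
  (\<open>set_integral_by_parts\<close>). The boundary terms at the four endpoints are the values of \<open>f * g\<close>
  there, with a plus sign at the right ends \<open>-e1\<close>, \<open>T2\<close> and a minus sign at the left ends \<open>-T1\<close>,
  \<open>e2\<close>. The deltas in \<open>delta_trc\<close> pick out the same four values with the opposite signs: a jump
  of the truncated function up from zero at a left end, down to zero at a right end. Adding the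
  two intervals therefore leaves only the integral of \<open>f * g'\<close>.

  The point \<open>0\<close>, where \<open>f\<close> may be singular, lies in the gap between the two intervals. Because of
  this gap, differentiation relative to the union agrees with differentiation relative to the
  interval at hand (\<open>at_within_trunc_set_left\<close>, \<open>at_within_trunc_set_right\<close>).\<close>

lemma C1_within_Icc:
  assumes "C1_within f {a..b}" and "a < b"
  shows "continuous_on {a..b} (\<lambda>t. vector_derivative f (at t within {a..b}))"
    and "\<And>t. t \<in> {a..b} \<Longrightarrow>
      (f has_vector_derivative vector_derivative f (at t within {a..b})) (at t within {a..b})"
proof -
  obtain D where cont: "continuous_on {a..b} D"
    and D: "\<And>t. t \<in> {a..b} \<Longrightarrow> (f has_vector_derivative D t) (at t within {a..b})"
    using assms(1) unfolding C1_within_def by blast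
  have eq: "vector_derivative f (at t within {a..b}) = D t" if "t \<in> {a..b}" for t
    using vector_derivative_within_cbox[of a b t f] assms(2) that D by auto
  show "continuous_on {a..b} (\<lambda>t. vector_derivative f (at t within {a..b}))"
    using cont by (rule continuous_on_eq) (simp add: eq)
  show "(f has_vector_derivative vector_derivative f (at t within {a..b})) (at t within {a..b})"
    if "t \<in> {a..b}" for t
    using D[OF that] by (simp only: eq[OF that])
qed

lemma smooth_fun_has_vector_derivative:
  assumes "smooth_fun g"
  shows "(g has_vector_derivative vector_derivative g (at t)) (at t within S)"
proof -
  have "((\<lambda>h s. vector_derivative h (at s)) ^^ 0) g differentiable (at t)"
    using assms unfolding smooth_fun_def by blast
  then have "(g has_vector_derivative vector_derivative g (at t)) (at t)"
    by (simp add: vector_derivative_works)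
  then show ?thesis
    by (rule has_vector_derivative_at_within)
qed

lemma smooth_fun_continuous_on_vector_derivative:
  assumes "smooth_fun g"
  shows "continuous_on S (\<lambda>t. vector_derivative g (at t))"
proof -
  have "((\<lambda>h s. vector_derivative h (at s)) ^^ 1) g differentiable (at t)" for t
    using assms unfolding smooth_fun_def by blast
  then show ?thesis
    by (intro continuous_at_imp_continuous_on ballI differentiable_imp_continuous_within) simp
qed

text \<open>This is the fundamental theorem of calculus for \<open>F * G\<close>. Continuity of both derivatives
  makes the two halves of the product rule integrable separately, so that the integral of their
  sum can be split.\<close>

lemma set_integral_by_parts:
  fixes F G F' G' :: "real \<Rightarrow> 'a::{real_normed_field, euclidean_space}"
  assumes "a \<le> b"
    and F: "\<And>t. t \<in> {a..b} \<Longrightarrow> (F has_vector_derivative F' t) (at t within {a..b})"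
    and G: "\<And>t. t \<in> {a..b} \<Longrightarrow> (G has_vector_derivative G' t) (at t within {a..b})"
    and F': "continuous_on {a..b} F'" and G': "continuous_on {a..b} G'"
  shows "set_integrable lborel {a..b} (\<lambda>t. F' t * G t)"
    and "set_integrable lborel {a..b} (\<lambda>t. F t * G' t)"
    and "(LBINT t:{a..b}. F' t * G t) = F b * G b - F a * G a - (LBINT t:{a..b}. F t * G' t)"
proof -
  have contF: "continuous_on {a..b} F" and contG: "continuous_on {a..b} G"
    by (rule continuous_on_vector_derivative, erule F, rule continuous_on_vector_derivative, erule G)
  show int1: "set_integrable lborel {a..b} (\<lambda>t. F' t * G t)"
    and int2: "set_integrable lborel {a..b} (\<lambda>t. F t * G' t)"
    by (intro borel_integrable_atLeastAtMost' continuous_on_mult F' G' contF contG)+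
  have "(LBINT t:{a..b}. F t * G' t + F' t * G t) = F b * G b - F a * G a"
    unfolding set_lebesgue_integral_def
    by (rule integral_FTC_atLeastAtMost[where F = "\<lambda>t. F t * G t"])
      (auto intro!: has_vector_derivative_mult F G continuous_intros F' G' contF contG assms(1))
  then show "(LBINT t:{a..b}. F' t * G t)
      = F b * G b - F a * G a - (LBINT t:{a..b}. F t * G' t)"
    using int1 int2 by (simp add: set_integral_add(2) algebra_simps)
qed

lemma at_within_trunc_set_left:
  assumes "0 < e1" and "0 < e2" and "t \<in> {-T1..-e1}"
  shows "at t within trunc_set T1 e1 e2 T2 = at t within {-T1..-e1}"
  by (rule at_within_nhd[of t "{..<0}"]) (use assms in \<open>auto simp: trunc_set_def\<close>)

lemma at_within_trunc_set_right:
  assumes "0 < e1" and "0 < e2" and "t \<in> {e2..T2}"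
  shows "at t within trunc_set T1 e1 e2 T2 = at t within {e2..T2}"
  by (rule at_within_nhd[of t "{0<..}"]) (use assms in \<open>auto simp: trunc_set_def\<close>)

lemma set_integral_trunc_set:
  fixes h :: "real \<Rightarrow> 'a::{banach, second_countable_topology}"
  assumes "0 < e1" and "0 < e2"
    and "set_integrable lborel {-T1..-e1} h" and "set_integrable lborel {e2..T2} h"
  shows "(LBINT t:trunc_set T1 e1 e2 T2. h t)
    = (LBINT t:{-T1..-e1}. h t) + (LBINT t:{e2..T2}. h t)"
  unfolding trunc_set_def by (rule set_integral_Un) (use assms in auto)

theorem theorem2p1:
  fixes f g :: "real \<Rightarrow> 'a::{real_normed_field, euclidean_space}"
    and T1 e1 e2 T2 :: real
  assumes "0 < e1" and "e1 < T1" and "0 < e2" and "e2 < T2"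
    and "C1_within f {-T1..-e1}" and "C1_within f {e2..T2}"
    and "smooth_fun g"
  shows "truncated_deriv T1 e1 e2 T2 f g =
         - (\<integral>t. truncated T1 e1 e2 T2 f t * vector_derivative g (at t) \<partial>lborel)"
proof -
  let ?S = "trunc_set T1 e1 e2 T2"
  define f' where "f' t = vector_derivative f (at t within ?S)" for t
  define g' where "g' t = vector_derivative g (at t)" for t
  have f'_left: "f' t = vector_derivative f (at t within {-T1..-e1})" if "t \<in> {-T1..-e1}" for t
    unfolding f'_def at_within_trunc_set_left[OF assms(1,3) that] ..
  have f'_right: "f' t = vector_derivative f (at t within {e2..T2})" if "t \<in> {e2..T2}" for t
    unfolding f'_def at_within_trunc_set_right[OF assms(1,3) that] ..
  have g': "(g has_vector_derivative g' t) (at t within S)" "continuous_on S g'" for t S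
    unfolding g'_def using smooth_fun_has_vector_derivative[OF assms(7)]
      smooth_fun_continuous_on_vector_derivative[OF assms(7)] by auto

  have "-T1 < -e1" using assms(2) by simp
  note C1_left = C1_within_Icc[OF assms(5) this]
  have "continuous_on {-T1..-e1} f'"
    using C1_left(1) by (rule continuous_on_eq) (simp add: f'_left)
  moreover have "(f has_vector_derivative f' t) (at t within {-T1..-e1})"
    if "t \<in> {-T1..-e1}" for t
    using C1_left(2)[OF that] by (simp only: f'_left[OF that])
  ultimately have left:
      "set_integrable lborel {-T1..-e1} (\<lambda>t. f' t * g t)"
      "set_integrable lborel {-T1..-e1} (\<lambda>t. f t * g' t)"
      "(LBINT t:{-T1..-e1}. f' t * g t)
        = f (-e1) * g (-e1) - f (-T1) * g (-T1) - (LBINT t:{-T1..-e1}. f t * g' t)"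
    using set_integral_by_parts[of "-T1" "-e1" f f' g g'] g' assms(2) by auto

  note C1_right = C1_within_Icc[OF assms(6,4)]
  have "continuous_on {e2..T2} f'"
    using C1_right(1) by (rule continuous_on_eq) (simp add: f'_right)
  moreover have "(f has_vector_derivative f' t) (at t within {e2..T2})" if "t \<in> {e2..T2}" for t
    using C1_right(2)[OF that] by (simp only: f'_right[OF that])
  ultimately have right:
      "set_integrable lborel {e2..T2} (\<lambda>t. f' t * g t)"
      "set_integrable lborel {e2..T2} (\<lambda>t. f t * g' t)"
      "(LBINT t:{e2..T2}. f' t * g t)
        = f T2 * g T2 - f e2 * g e2 - (LBINT t:{e2..T2}. f t * g' t)"
    using set_integral_by_parts[of e2 T2 f f' g g'] g' assms(4) by auto

  have "truncated_deriv T1 e1 e2 T2 f g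
      = (LBINT t:?S. f' t * g t) + delta_trc T1 e1 e2 T2 f g"
    by (simp add: truncated_deriv_def regular_def set_lebesgue_integral_def f'_def)
  also have "\<dots> = - (LBINT t:?S. f t * g' t)"
    using set_integral_trunc_set[OF assms(1,3) left(1) right(1)]
      set_integral_trunc_set[OF assms(1,3) left(2) right(2)] left(3) right(3)
    by (simp add: delta_trc_def dirac_def)
  also have "(LBINT t:?S. f t * g' t)
      = (\<integral>t. truncated T1 e1 e2 T2 f t * vector_derivative g (at t) \<partial>lborel)"
    unfolding set_lebesgue_integral_def g'_def
    by (rule Bochner_Integration.integral_cong) (auto simp: truncated_def)
  finally show ?thesis .
qed

end
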